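(* Let $G$ be a unique product monoid, $I$ a $G$-invariant ideal of $R$, and $S=R*G$ a crossed product. Suppose $R$ satisfies the ascending chain condition on (two-sided) ideals and $\sigma$ is pointwise surjective. Then $I$ is $S$-prime (i.e. $IS$ is a prime ideal of $S$) if and only if whenever $J,K$ are $G$-invariant ideals of $R$ with $JK\subseteq I$, we have $J\subseteq I$ or $K\subseteq I$.
   Context: Rings have $1$, ideals are two-sided. A unique product monoid is a monoid $G$ (identity $e$) such that whenever $X,Y$ are nonempty finite subsets of $G$, there exist $x\in X$, $y\in Y$ with $xy\ne x'y'$ for every pair $(x',y')\in X\times Y$ different from $(x,y)$. A crossed product $S=R*G$ is determined by a ring $R$, a monoid $G$, and functions $\sigma:G\to\operatorname{End}_{\mathrm{Ring}}(R)$ and $c:G\times G\to GL_1(R)$ (units of $R$); write $r^g=\sigma(g)(r)$. $S=\bigoplus_{g\in G}R\overline{g}$ is a free left $R$-module with basis $\{\overline g:g\in G\}$ and multiplication determined by $\overline g\, r=r^g\,\overline g$ and $\overline g\,\overline h=c(g,h)\overline{gh}$, where for all $r\in R$, $g,h,i\in G$: $r^e=r$; $c(g,e)=c(e,g)=1$; $(r^h)^g c(g,h)=c(g,h)r^{gh}$; $c(g,h)c(gh,i)=c(h,i)^g c(g,hi)$. $R$ is identified with $R\overline e$. $\sigma$ is pointwise surjective if $\sigma(g)$ is surjective for all $g\in G$. An ideal $I$ of $R$ is $G$-invariant if $\sigma(g)^{-1}(I)=I$ for all $g\in G$.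
   Formalization: The condition that I is a proper ideal (I ≠ R) is added to the right-hand side of the equivalence: prime ideals are proper, so for I = R the ideal IS = S is not prime although the condition on J and K holds trivially. *)

theory Defs
  imports "HOL-Algebra.Ideal_Product"
begin

definition unique_product_monoid :: "('g, 'n) monoid_scheme \<Rightarrow> bool" where
  "unique_product_monoid G \<longleftrightarrow> monoid G \<and>
     (\<forall>X Y. finite X \<and> X \<noteq> {} \<and> X \<subseteq> carrier G \<and> finite Y \<and> Y \<noteq> {} \<and> Y \<subseteq> carrier G \<longrightarrow>
        (\<exists>x\<in>X. \<exists>y\<in>Y. \<forall>x'\<in>X. \<forall>y'\<in>Y. (x', y') \<noteq> (x, y) \<longrightarrow>
           x \<otimes>\<^bsub>G\<^esub> y \<noteq> x' \<otimes>\<^bsub>G\<^esub> y'))"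

locale crossed_system = R: ring R + G: monoid G
  for R :: "('r, 'm) ring_scheme" (structure) and G :: "('g, 'n) monoid_scheme" +
  fixes \<sigma> :: "'g \<Rightarrow> 'r \<Rightarrow> 'r" and c :: "'g \<Rightarrow> 'g \<Rightarrow> 'r"
  assumes sigma_hom: "g \<in> carrier G \<Longrightarrow> \<sigma> g \<in> ring_hom R R"
    and c_unit: "\<lbrakk>g \<in> carrier G; h \<in> carrier G\<rbrakk> \<Longrightarrow> c g h \<in> Units R"
    and sigma_one: "r \<in> carrier R \<Longrightarrow> \<sigma> \<one>\<^bsub>G\<^esub> r = r"
    and c_one_right: "g \<in> carrier G \<Longrightarrow> c g \<one>\<^bsub>G\<^esub> = \<one>"
    and c_one_left: "g \<in> carrier G \<Longrightarrow> c \<one>\<^bsub>G\<^esub> g = \<one>"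
    and sigma_twist: "\<lbrakk>g \<in> carrier G; h \<in> carrier G; r \<in> carrier R\<rbrakk> \<Longrightarrow>
          \<sigma> g (\<sigma> h r) \<otimes> c g h = c g h \<otimes> \<sigma> (g \<otimes>\<^bsub>G\<^esub> h) r"
    and c_cocycle: "\<lbrakk>g \<in> carrier G; h \<in> carrier G; i \<in> carrier G\<rbrakk> \<Longrightarrow>
          c g h \<otimes> c (g \<otimes>\<^bsub>G\<^esub> h) i = \<sigma> g (c h i) \<otimes> c g (h \<otimes>\<^bsub>G\<^esub> i)"

definition cp_supp :: "('r, 'm) ring_scheme \<Rightarrow> ('g \<Rightarrow> 'r) \<Rightarrow> 'g set" where
  "cp_supp R f = {g. f g \<noteq> \<zero>\<^bsub>R\<^esub>}"

text \<open>Write \<open>u x\<close> for the basis element of \<open>R * G\<close> belonging to \<open>x\<close>. The element \<open>\<Sum>x. f x u x\<close> is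
  represented by its coefficient function \<open>f\<close>, which is required to be zero outside \<open>carrier G\<close>.
  The rules \<open>u x s = (\<sigma> x s) u x\<close> and \<open>u x u y = c x y u (xy)\<close> force
  \<open>(r u x) (s u y) = r (\<sigma> x s) (c x y) u (xy)\<close>, and the multiplication is the biadditive
  extension of this.\<close>

definition crossed_product ::
  "('r, 'm) ring_scheme \<Rightarrow> ('g, 'n) monoid_scheme \<Rightarrow> ('g \<Rightarrow> 'r \<Rightarrow> 'r) \<Rightarrow> ('g \<Rightarrow> 'g \<Rightarrow> 'r) \<Rightarrow>
   ('g \<Rightarrow> 'r) ring" where
  "crossed_product R G \<sigma> c =
    \<lparr> carrier = {f. f \<in> carrier G \<rightarrow> carrier R \<and> cp_supp R f \<subseteq> carrier G \<and> finite (cp_supp R f)},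
      mult = (\<lambda>f f' k. finsum R (\<lambda>(x, y). f x \<otimes>\<^bsub>R\<^esub> \<sigma> x (f' y) \<otimes>\<^bsub>R\<^esub> c x y)
                 {(x, y) \<in> cp_supp R f \<times> cp_supp R f'. x \<otimes>\<^bsub>G\<^esub> y = k}),
      one = (\<lambda>k. if k = \<one>\<^bsub>G\<^esub> then \<one>\<^bsub>R\<^esub> else \<zero>\<^bsub>R\<^esub>),
      zero = (\<lambda>k. \<zero>\<^bsub>R\<^esub>),
      add = (\<lambda>f f' k. f k \<oplus>\<^bsub>R\<^esub> f' k) \<rparr>"

text \<open>\<open>cp_monom R g r\<close> is \<open>r u g\<close>.\<close>

definition cp_monom :: "('r, 'm) ring_scheme \<Rightarrow> 'g \<Rightarrow> 'r \<Rightarrow> 'g \<Rightarrow> 'r" where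
  "cp_monom R g r = (\<lambda>k. if k = g then r else \<zero>\<^bsub>R\<^esub>)"

definition cp_embed :: "('r, 'm) ring_scheme \<Rightarrow> ('g, 'n) monoid_scheme \<Rightarrow> 'r \<Rightarrow> 'g \<Rightarrow> 'r" where
  "cp_embed R G = cp_monom R \<one>\<^bsub>G\<^esub>"

lemma (in crossed_system) cp_monom_closed:
  assumes "g \<in> carrier G" "r \<in> carrier R"
  shows "cp_monom R g r \<in> carrier (crossed_product R G \<sigma> c)"
proof -
  have "cp_supp R (cp_monom R g r) \<subseteq> {g}"
    by (auto simp: cp_supp_def cp_monom_def)
  then show ?thesis
    using assms
    by (auto simp: crossed_product_def cp_monom_def intro: finite_subset)
qed

lemma (in crossed_system) cp_monom_mult:
  assumes g: "g \<in> carrier G" and h: "h \<in> carrier G" and r: "r \<in> carrier R" and s: "s \<in> carrier R"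
  shows "cp_monom R g r \<otimes>\<^bsub>crossed_product R G \<sigma> c\<^esub> cp_monom R h s =
         cp_monom R (g \<otimes>\<^bsub>G\<^esub> h) (r \<otimes> \<sigma> g s \<otimes> c g h)"
proof
  fix k
  have hom: "\<sigma> g \<in> ring_hom R R" by (rule sigma_hom[OF g])
  have sg: "\<sigma> g s \<in> carrier R" using ring_hom_closed[OF hom s] .
  have s0: "\<sigma> g \<zero> = \<zero>" by (rule ring_hom_zero[OF hom R.ring_axioms R.ring_axioms])
  have cc: "c g h \<in> carrier R" using c_unit[OF g h] by (rule R.Units_closed)
  let ?A = "{(x, y) \<in> cp_supp R (cp_monom R g r) \<times> cp_supp R (cp_monom R h s). x \<otimes>\<^bsub>G\<^esub> y = k}"
  have A: "?A = (if r \<noteq> \<zero> \<and> s \<noteq> \<zero> \<and> g \<otimes>\<^bsub>G\<^esub> h = k then {(g, h)} else {})"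
    by (auto simp: cp_supp_def cp_monom_def split: if_splits)
  have "(cp_monom R g r \<otimes>\<^bsub>crossed_product R G \<sigma> c\<^esub> cp_monom R h s) k =
        finsum R (\<lambda>(x, y). cp_monom R g r x \<otimes> \<sigma> x (cp_monom R h s y) \<otimes> c x y) ?A"
    by (simp add: crossed_product_def)
  also have "\<dots> = (if r \<noteq> \<zero> \<and> s \<noteq> \<zero> \<and> g \<otimes>\<^bsub>G\<^esub> h = k then r \<otimes> \<sigma> g s \<otimes> c g h else \<zero>)"
    unfolding A using r sg cc by (simp add: cp_monom_def)
  also have "\<dots> = cp_monom R (g \<otimes>\<^bsub>G\<^esub> h) (r \<otimes> \<sigma> g s \<otimes> c g h) k"
    using r sg cc s0 by (auto simp: cp_monom_def)
  finally show "(cp_monom R g r \<otimes>\<^bsub>crossed_product R G \<sigma> c\<^esub> cp_monom R h s) k =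
        cp_monom R (g \<otimes>\<^bsub>G\<^esub> h) (r \<otimes> \<sigma> g s \<otimes> c g h) k" .
qed

definition G_invariant_ideal ::
  "('r, 'm) ring_scheme \<Rightarrow> ('g, 'n) monoid_scheme \<Rightarrow> ('g \<Rightarrow> 'r \<Rightarrow> 'r) \<Rightarrow> 'r set \<Rightarrow> bool" where
  "G_invariant_ideal R G \<sigma> I \<longleftrightarrow>
     ideal I R \<and> (\<forall>g\<in>carrier G. {r \<in> carrier R. \<sigma> g r \<in> I} = I)"

definition acc_on_ideals :: "('r, 'm) ring_scheme \<Rightarrow> bool" where
  "acc_on_ideals R \<longleftrightarrow>
     (\<forall>C :: nat \<Rightarrow> 'r set. (\<forall>n. ideal (C n) R) \<and> (\<forall>n. C n \<subseteq> C (Suc n)) \<longrightarrow>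
        (\<exists>n. \<forall>m\<ge>n. C m = C n))"

text \<open>The library's \<open>primeideal\<close> is restricted to commutative rings and is elementwise; for
  noncommutative rings primeness is expressed through products of two-sided ideals.\<close>

definition prime_two_sided_ideal :: "'a set \<Rightarrow> ('a, 'm) ring_scheme \<Rightarrow> bool" where
  "prime_two_sided_ideal P S \<longleftrightarrow> ideal P S \<and> P \<noteq> carrier S \<and>
     (\<forall>A B. ideal A S \<and> ideal B S \<and> A \<cdot>\<^bsub>S\<^esub> B \<subseteq> P \<longrightarrow> A \<subseteq> P \<or> B \<subseteq> P)"

text \<open>\<open>I S\<close> is the set of finite sums of products \<open>a s\<close> with \<open>a\<close> in the image of \<open>I\<close> in \<open>S\<close>
  and \<open>s\<close> in \<open>S\<close>; \<open>ideal_prod\<close> yields this for arbitrary subsets.\<close>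

definition cp_extension ::
  "('r, 'm) ring_scheme \<Rightarrow> ('g, 'n) monoid_scheme \<Rightarrow> ('g \<Rightarrow> 'r \<Rightarrow> 'r) \<Rightarrow> ('g \<Rightarrow> 'g \<Rightarrow> 'r) \<Rightarrow>
   'r set \<Rightarrow> ('g \<Rightarrow> 'r) set" where
  "cp_extension R G \<sigma> c I =
     (cp_embed R G ` I) \<cdot>\<^bsub>crossed_product R G \<sigma> c\<^esub> carrier (crossed_product R G \<sigma> c)"

definition S_prime ::
  "('r, 'm) ring_scheme \<Rightarrow> ('g, 'n) monoid_scheme \<Rightarrow> ('g \<Rightarrow> 'r \<Rightarrow> 'r) \<Rightarrow> ('g \<Rightarrow> 'g \<Rightarrow> 'r) \<Rightarrow>
   'r set \<Rightarrow> bool" where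
  "S_prime R G \<sigma> c I \<longleftrightarrow>
     prime_two_sided_ideal (cp_extension R G \<sigma> c I) (crossed_product R G \<sigma> c)"

end

theory Submission
  imports Defs
begin

text \<open>\<open>IS\<close> consists of the elements of \<open>S\<close> all of whose coefficients lie in \<open>I\<close>, which settles the
  forward implication. For the converse, use ACC to choose \<open>u \<notin> I\<close> such that
  \<open>P = {t. u R t \<subseteq> I}\<close> is maximal among the right annihilators of this form. By the primeness of \<open>I\<close>
  with respect to invariant ideals, every \<open>b \<notin> I\<close> has \<open>\<sigma> h b \<notin> P\<close> for some \<open>h\<close>, and every \<open>a \<notin> I\<close>
  has \<open>a R \<sigma> g u\<close> not contained in \<open>I\<close> for some \<open>g\<close>. Hence, if ideals \<open>A\<close> and \<open>B\<close> of \<open>S\<close>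
  are not contained in \<open>IS\<close>, multiplying by basis elements yields \<open>a \<in> A\<close> and \<open>b \<in> B\<close> for which
  \<open>X = {x. \<not> a x R \<sigma> x u \<subseteq> I}\<close> and \<open>Y = {y. b y \<notin> P}\<close> are nonempty. Let \<open>x0 y0\<close> be a unique
  product of \<open>X\<close> and \<open>Y\<close>. In \<open>a (t u r) b\<close> with \<open>t, r \<in> R\<close>, every other contribution to the
  coefficient at \<open>x0 y0\<close> lies in \<open>I\<close>, and the maximality of \<open>P\<close> allows \<open>t\<close> and \<open>r\<close> to be chosen
  such that the contribution of \<open>(x0, y0)\<close> does not. So \<open>A B\<close> is not contained in \<open>IS\<close>.\<close>

section \<open>The crossed product as a ring\<close>

text \<open>Closure under negation comes from left multiplication by
  \<open>\<ominus> \<one>\<close>.\<close>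

lemma (in ring) ideal_criterion:
  assumes sub: "I \<subseteq> carrier R" and zero: "\<zero> \<in> I"
    and add: "\<And>a b. \<lbrakk>a \<in> I; b \<in> I\<rbrakk> \<Longrightarrow> a \<oplus> b \<in> I"
    and left: "\<And>a x. \<lbrakk>a \<in> I; x \<in> carrier R\<rbrakk> \<Longrightarrow> x \<otimes> a \<in> I"
    and right: "\<And>a x. \<lbrakk>a \<in> I; x \<in> carrier R\<rbrakk> \<Longrightarrow> a \<otimes> x \<in> I"
  shows "ideal I R"
proof (rule idealI[OF ring_axioms])
  show "subgroup I (add_monoid R)"
  proof (rule add.subgroupI)
    fix a assume a: "a \<in> I"
    then have "a \<in> carrier R" using sub by blast
    then have "\<ominus> a = (\<ominus> \<one>) \<otimes> a" by (simp add: l_minus)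
    then show "\<ominus> a \<in> I" using left[OF a] by simp
  qed (use assms in auto)
qed (use left right in auto)

lemma (in ideal) finsum_mem:
  assumes "finite A" "\<And>x. x \<in> A \<Longrightarrow> f x \<in> I"
  shows "finsum R f A \<in> I"
  using assms
proof (induction A rule: finite_induct)
  case empty
  then show ?case by simp
next
  case (insert x F)
  then have "f \<in> F \<rightarrow> carrier R" "f x \<in> carrier R" by (auto intro: Icarr)
  then show ?case using insert by (simp add: finsum_insert)
qed

context crossed_system
begin

abbreviation "S \<equiv> crossed_product R G \<sigma> c"

abbreviation cp_term :: "('g \<Rightarrow> 'r) \<Rightarrow> ('g \<Rightarrow> 'r) \<Rightarrow> 'g \<times> 'g \<Rightarrow> 'r" where
  "cp_term f f' \<equiv> \<lambda>(x, y). f x \<otimes> \<sigma> x (f' y) \<otimes> c x y"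

lemma sigma_closed [simp]: "g \<in> carrier G \<Longrightarrow> r \<in> carrier R \<Longrightarrow> \<sigma> g r \<in> carrier R"
  using ring_hom_closed[OF sigma_hom] .

lemma sigma_add: "g \<in> carrier G \<Longrightarrow> r \<in> carrier R \<Longrightarrow> s \<in> carrier R \<Longrightarrow> \<sigma> g (r \<oplus> s) = \<sigma> g r \<oplus> \<sigma> g s"
  using ring_hom_add[OF sigma_hom] .

lemma sigma_mult: "g \<in> carrier G \<Longrightarrow> r \<in> carrier R \<Longrightarrow> s \<in> carrier R \<Longrightarrow> \<sigma> g (r \<otimes> s) = \<sigma> g r \<otimes> \<sigma> g s"
  using ring_hom_mult[OF sigma_hom] .

lemma sigma_unit [simp]: "g \<in> carrier G \<Longrightarrow> \<sigma> g \<one> = \<one>"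
  using ring_hom_one[OF sigma_hom] .

lemma sigma_zero [simp]: "g \<in> carrier G \<Longrightarrow> \<sigma> g \<zero> = \<zero>"
  using ring_hom_zero[OF sigma_hom R.ring_axioms R.ring_axioms] .

lemma c_closed [simp]: "g \<in> carrier G \<Longrightarrow> h \<in> carrier G \<Longrightarrow> c g h \<in> carrier R"
  using c_unit by (rule R.Units_closed)

text \<open>Outside \<open>carrier G\<close> a coefficient is zero and hence in
  \<open>carrier R\<close>, so the condition on coefficients can range over the whole type.\<close>

lemma S_carrier:
  "f \<in> carrier S \<longleftrightarrow> (\<forall>x. f x \<in> carrier R) \<and> cp_supp R f \<subseteq> carrier G \<and> finite (cp_supp R f)"
proof -
  have "(\<forall>x. f x \<in> carrier R)" if "f \<in> carrier G \<rightarrow> carrier R" "cp_supp R f \<subseteq> carrier G"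
  proof
    fix x
    have "x \<notin> carrier G \<Longrightarrow> x \<notin> cp_supp R f" using that by blast
    then show "f x \<in> carrier R"
      using that(1) by (cases "x \<in> carrier G") (auto simp: cp_supp_def)
  qed
  then show ?thesis by (auto simp: crossed_product_def)
qed

lemma S_coeff: "f \<in> carrier S \<Longrightarrow> f x \<in> carrier R"
  by (simp add: S_carrier)

lemma S_zero: "\<zero>\<^bsub>S\<^esub> = (\<lambda>k. \<zero>)"
  by (simp add: crossed_product_def)

lemma S_one: "\<one>\<^bsub>S\<^esub> = cp_monom R \<one>\<^bsub>G\<^esub> \<one>"
  by (auto simp: crossed_product_def cp_monom_def)

lemma S_add: "f \<oplus>\<^bsub>S\<^esub> f' = (\<lambda>k. f k \<oplus> f' k)"
  by (simp add: crossed_product_def)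

lemma S_add_closed:
  assumes f: "f \<in> carrier S" "f' \<in> carrier S"
  shows "f \<oplus>\<^bsub>S\<^esub> f' \<in> carrier S"
proof -
  have "cp_supp R (f \<oplus>\<^bsub>S\<^esub> f') \<subseteq> cp_supp R f \<union> cp_supp R f'"
    by (auto simp: cp_supp_def S_add)
  then show ?thesis using f
    unfolding S_carrier by (auto simp: S_add intro: finite_subset)
qed

lemma S_abelian_group: "abelian_group S"
proof (rule abelian_groupI)
  show "\<zero>\<^bsub>S\<^esub> \<in> carrier S" by (simp add: S_carrier S_zero cp_supp_def)
  fix f assume f: "f \<in> carrier S"
  note [simp] = S_coeff[OF f]
  have "cp_supp R (\<lambda>k. \<ominus> f k) = cp_supp R f"
    using f by (auto simp: cp_supp_def)
  then have "(\<lambda>k. \<ominus> f k) \<in> carrier S" using f by (simp add: S_carrier)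
  moreover have "(\<lambda>k. \<ominus> f k) \<oplus>\<^bsub>S\<^esub> f = \<zero>\<^bsub>S\<^esub>" using f by (simp add: S_add S_zero R.l_neg)
  ultimately show "\<exists>y\<in>carrier S. y \<oplus>\<^bsub>S\<^esub> f = \<zero>\<^bsub>S\<^esub>" by blast
qed (simp_all add: S_add_closed, simp_all add: S_add S_zero R.a_ac S_coeff)

text \<open>Terms outside the supports vanish. The free choice of \<open>X\<close> and
  \<open>Y\<close> lets products with different supports be compared over one index set, as
  distributivity requires.\<close>

lemma S_mult_eq:
  assumes f: "f \<in> carrier S" "f' \<in> carrier S"
    and X: "finite X" "X \<subseteq> carrier G" "cp_supp R f \<subseteq> X"
    and Y: "finite Y" "Y \<subseteq> carrier G" "cp_supp R f' \<subseteq> Y"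
  shows "(f \<otimes>\<^bsub>S\<^esub> f') k = finsum R (cp_term f f') {(x, y) \<in> X \<times> Y. x \<otimes>\<^bsub>G\<^esub> y = k}"
proof -
  note [simp] = f[THEN S_coeff]
  let ?A = "{(x, y) \<in> cp_supp R f \<times> cp_supp R f'. x \<otimes>\<^bsub>G\<^esub> y = k}"
  let ?B = "{(x, y) \<in> X \<times> Y. x \<otimes>\<^bsub>G\<^esub> y = k}"
  have "finsum R (cp_term f f') ?A = finsum R (cp_term f f') ?B"
  proof (rule R.add.finprod_mono_neutral_cong_left)
    show "finite ?B"
      by (rule finite_subset[of _ "X \<times> Y"]) (use X Y in auto)
    show "?A \<subseteq> ?B" using X(3) Y(3) by blast
    show "cp_term f f' \<in> ?B \<rightarrow> carrier R"
      using f subsetD[OF X(2)] subsetD[OF Y(2)] by auto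
    fix i assume i: "i \<in> ?B - ?A"
    obtain x y where xy: "i = (x, y)" by (cases i)
    then have xyG: "x \<in> carrier G" "y \<in> carrier G" and "f x = \<zero> \<or> f' y = \<zero>"
      using i X(2) Y(2) by (auto simp: cp_supp_def)
    then show "cp_term f f' i = \<zero>" using f by (auto simp: xy)
  qed simp
  then show ?thesis by (simp add: crossed_product_def)
qed

lemma S_mult_closed:
  assumes f: "f \<in> carrier S" "f' \<in> carrier S"
  shows "f \<otimes>\<^bsub>S\<^esub> f' \<in> carrier S"
proof -
  note [simp] = f[THEN S_coeff]
  let ?X = "cp_supp R f" and ?Y = "cp_supp R f'"
  have XY: "finite ?X" "?X \<subseteq> carrier G" "finite ?Y" "?Y \<subseteq> carrier G"
    using f by (auto simp: S_carrier)
  have eq: "(f \<otimes>\<^bsub>S\<^esub> f') k = finsum R (cp_term f f') {(x, y) \<in> ?X \<times> ?Y. x \<otimes>\<^bsub>G\<^esub> y = k}" for k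
    by (rule S_mult_eq) (use f XY subsetD[OF XY(2)] subsetD[OF XY(4)] in auto)
  have "(f \<otimes>\<^bsub>S\<^esub> f') k \<in> carrier R" for k
    unfolding eq by (rule R.finsum_closed) (use f XY subsetD[OF XY(2)] subsetD[OF XY(4)] in auto)
  moreover have "cp_supp R (f \<otimes>\<^bsub>S\<^esub> f') \<subseteq> (\<lambda>(x, y). x \<otimes>\<^bsub>G\<^esub> y) ` (?X \<times> ?Y)"
  proof
    fix k assume "k \<in> cp_supp R (f \<otimes>\<^bsub>S\<^esub> f')"
    then have "finsum R (cp_term f f') {(x, y) \<in> ?X \<times> ?Y. x \<otimes>\<^bsub>G\<^esub> y = k} \<noteq> \<zero>"
      using eq by (simp add: cp_supp_def)
    then have "{(x, y) \<in> ?X \<times> ?Y. x \<otimes>\<^bsub>G\<^esub> y = k} \<noteq> {}"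
      by (metis R.finsum_empty)
    then show "k \<in> (\<lambda>(x, y). x \<otimes>\<^bsub>G\<^esub> y) ` (?X \<times> ?Y)" by auto
  qed
  moreover have "(\<lambda>(x, y). x \<otimes>\<^bsub>G\<^esub> y) ` (?X \<times> ?Y) \<subseteq> carrier G" using XY by auto
  ultimately show ?thesis unfolding S_carrier
    using XY by (meson finite_SigmaI finite_imageI finite_subset subset_trans)
qed

lemma S_l_distr:
  assumes f: "f \<in> carrier S" "f' \<in> carrier S" "h \<in> carrier S"
  shows "(f \<oplus>\<^bsub>S\<^esub> f') \<otimes>\<^bsub>S\<^esub> h = f \<otimes>\<^bsub>S\<^esub> h \<oplus>\<^bsub>S\<^esub> f' \<otimes>\<^bsub>S\<^esub> h"
proof
  note [simp] = f[THEN S_coeff]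
  fix k
  let ?X = "cp_supp R f \<union> cp_supp R f'" and ?Y = "cp_supp R h"
  let ?A = "{(x, y) \<in> ?X \<times> ?Y. x \<otimes>\<^bsub>G\<^esub> y = k}"
  have XY: "finite ?X" "?X \<subseteq> carrier G" "finite ?Y" "?Y \<subseteq> carrier G"
    using f by (auto simp: S_carrier)
  have sup: "cp_supp R (f \<oplus>\<^bsub>S\<^esub> f') \<subseteq> ?X" by (auto simp: cp_supp_def S_add)
  have "((f \<oplus>\<^bsub>S\<^esub> f') \<otimes>\<^bsub>S\<^esub> h) k = finsum R (cp_term (f \<oplus>\<^bsub>S\<^esub> f') h) ?A"
    by (rule S_mult_eq) (use f XY sup S_add_closed in auto)
  also have "\<dots> = finsum R (\<lambda>p. cp_term f h p \<oplus> cp_term f' h p) ?A"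
    by (rule R.finsum_cong') (use f XY subsetD[OF XY(2)] subsetD[OF XY(4)] in \<open>auto simp: S_add R.l_distr\<close>)
  also have "\<dots> = finsum R (cp_term f h) ?A \<oplus> finsum R (cp_term f' h) ?A"
    by (rule R.finsum_addf) (use f XY subsetD[OF XY(2)] subsetD[OF XY(4)] in auto)
  also have "finsum R (cp_term f h) ?A = (f \<otimes>\<^bsub>S\<^esub> h) k"
    by (rule S_mult_eq[symmetric]) (use f XY subsetD[OF XY(2)] subsetD[OF XY(4)] in auto)
  also have "finsum R (cp_term f' h) ?A = (f' \<otimes>\<^bsub>S\<^esub> h) k"
    by (rule S_mult_eq[symmetric]) (use f XY subsetD[OF XY(2)] subsetD[OF XY(4)] in auto)
  finally show "((f \<oplus>\<^bsub>S\<^esub> f') \<otimes>\<^bsub>S\<^esub> h) k = (f \<otimes>\<^bsub>S\<^esub> h \<oplus>\<^bsub>S\<^esub> f' \<otimes>\<^bsub>S\<^esub> h) k"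
    by (simp add: S_add)
qed

lemma S_r_distr:
  assumes f: "f \<in> carrier S" "f' \<in> carrier S" "h \<in> carrier S"
  shows "h \<otimes>\<^bsub>S\<^esub> (f \<oplus>\<^bsub>S\<^esub> f') = h \<otimes>\<^bsub>S\<^esub> f \<oplus>\<^bsub>S\<^esub> h \<otimes>\<^bsub>S\<^esub> f'"
proof
  note [simp] = f[THEN S_coeff]
  fix k
  let ?Y = "cp_supp R f \<union> cp_supp R f'" and ?X = "cp_supp R h"
  let ?A = "{(x, y) \<in> ?X \<times> ?Y. x \<otimes>\<^bsub>G\<^esub> y = k}"
  have XY: "finite ?X" "?X \<subseteq> carrier G" "finite ?Y" "?Y \<subseteq> carrier G"
    using f by (auto simp: S_carrier)
  have sup: "cp_supp R (f \<oplus>\<^bsub>S\<^esub> f') \<subseteq> ?Y" by (auto simp: cp_supp_def S_add)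
  have "(h \<otimes>\<^bsub>S\<^esub> (f \<oplus>\<^bsub>S\<^esub> f')) k = finsum R (cp_term h (f \<oplus>\<^bsub>S\<^esub> f')) ?A"
    by (rule S_mult_eq) (use f XY sup S_add_closed in auto)
  also have "\<dots> = finsum R (\<lambda>p. cp_term h f p \<oplus> cp_term h f' p) ?A"
    by (rule R.finsum_cong')
      (use f XY subsetD[OF XY(2)] subsetD[OF XY(4)] in
        \<open>auto simp: S_add sigma_add R.l_distr R.r_distr\<close>)
  also have "\<dots> = finsum R (cp_term h f) ?A \<oplus> finsum R (cp_term h f') ?A"
    by (rule R.finsum_addf) (use f XY subsetD[OF XY(2)] subsetD[OF XY(4)] in auto)
  also have "finsum R (cp_term h f) ?A = (h \<otimes>\<^bsub>S\<^esub> f) k"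
    by (rule S_mult_eq[symmetric]) (use f XY subsetD[OF XY(2)] subsetD[OF XY(4)] in auto)
  also have "finsum R (cp_term h f') ?A = (h \<otimes>\<^bsub>S\<^esub> f') k"
    by (rule S_mult_eq[symmetric]) (use f XY subsetD[OF XY(2)] subsetD[OF XY(4)] in auto)
  finally show "(h \<otimes>\<^bsub>S\<^esub> (f \<oplus>\<^bsub>S\<^esub> f')) k = (h \<otimes>\<^bsub>S\<^esub> f \<oplus>\<^bsub>S\<^esub> h \<otimes>\<^bsub>S\<^esub> f') k"
    by (simp add: S_add)
qed

text \<open>Peels off one support point at a time. The set \<open>J\<close> records where the
  removed coefficients lie: it is \<open>carrier R\<close> for the ring laws and an ideal when an
  element of \<open>IS\<close> is decomposed.\<close>

lemma S_induct [consumes 2, case_names zero monom]: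
  assumes f: "f \<in> carrier S" and fJ: "\<And>x. f x \<in> J"
    and zero: "P \<zero>\<^bsub>S\<^esub>"
    and step: "\<And>g r h. \<lbrakk>g \<in> carrier G; r \<in> J; r \<in> carrier R; h \<in> carrier S; P h\<rbrakk>
      \<Longrightarrow> P (cp_monom R g r \<oplus>\<^bsub>S\<^esub> h)"
  shows "P f"
proof -
  have "finite (cp_supp R f)" using f by (simp add: S_carrier)
  \<comment> \<open>Deleting a coefficient puts zero in its place, and zero need not lie in
    \<open>J\<close>; hence the weaker condition in the generalised claim.\<close>
  moreover have "P f" if "finite A" "cp_supp R f = A" "f \<in> carrier S" "\<And>x. f x \<in> J \<union> {\<zero>}" for f A
    using that
  proof (induction A arbitrary: f rule: finite_induct)
    case empty
    then have "f = \<zero>\<^bsub>S\<^esub>" by (auto simp: cp_supp_def S_zero)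
    then show ?case using zero by simp
  next
    case (insert g A)
    let ?h = "f(g := \<zero>)"
    have supp: "cp_supp R ?h = A" using insert.hyps insert.prems(1) by (auto simp: cp_supp_def)
    have g: "g \<in> carrier G" using insert.prems by (auto simp: S_carrier)
    have h: "?h \<in> carrier S" using insert supp by (auto simp: S_carrier)
    have "f g \<noteq> \<zero>" using insert.prems(1) by (auto simp: cp_supp_def)
    then have r: "f g \<in> J" using insert.prems(3)[of g] by blast
    have "P ?h" by (rule insert.IH[OF supp h]) (use insert.prems in auto)
    then have "P (cp_monom R g (f g) \<oplus>\<^bsub>S\<^esub> ?h)"
      using step[OF g r _ h] S_coeff[OF insert.prems(2)] by simp
    moreover have "cp_monom R g (f g) \<oplus>\<^bsub>S\<^esub> ?h = f"
      using S_coeff[OF insert.prems(2)] by (auto simp: S_add cp_monom_def)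
    ultimately show ?case by simp
  qed
  ultimately show ?thesis using f fJ by blast
qed

lemma S_zero_mult: "f \<in> carrier S \<Longrightarrow> \<zero>\<^bsub>S\<^esub> \<otimes>\<^bsub>S\<^esub> f = \<zero>\<^bsub>S\<^esub>"
  and S_mult_zero: "f \<in> carrier S \<Longrightarrow> f \<otimes>\<^bsub>S\<^esub> \<zero>\<^bsub>S\<^esub> = \<zero>\<^bsub>S\<^esub>"
  by (auto simp: crossed_product_def cp_supp_def fun_eq_iff)

lemma S_zero_closed: "\<zero>\<^bsub>S\<^esub> \<in> carrier S"
  using S_abelian_group by (simp add: abelian_group_def abelian_monoid.zero_closed)

lemmas S_closed = S_add_closed S_mult_closed S_zero_closed cp_monom_closed

text \<open>The twist relation moves \<open>c g h\<close> to the right past the image of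
  \<open>t\<close>, and the cocycle identity then regroups the two units.\<close>

lemma S_assoc_monom:
  assumes "g \<in> carrier G" "h \<in> carrier G" "i \<in> carrier G"
    "r \<in> carrier R" "s \<in> carrier R" "t \<in> carrier R"
  shows "(cp_monom R g r \<otimes>\<^bsub>S\<^esub> cp_monom R h s) \<otimes>\<^bsub>S\<^esub> cp_monom R i t =
    cp_monom R g r \<otimes>\<^bsub>S\<^esub> (cp_monom R h s \<otimes>\<^bsub>S\<^esub> cp_monom R i t)"
proof -
  note [simp] = assms
  have "(r \<otimes> \<sigma> g s \<otimes> c g h) \<otimes> \<sigma> (g \<otimes>\<^bsub>G\<^esub> h) t \<otimes> c (g \<otimes>\<^bsub>G\<^esub> h) i =
      r \<otimes> \<sigma> g s \<otimes> (c g h \<otimes> \<sigma> (g \<otimes>\<^bsub>G\<^esub> h) t) \<otimes> c (g \<otimes>\<^bsub>G\<^esub> h) i"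
    by (simp add: R.m_assoc)
  also have "\<dots> = r \<otimes> \<sigma> g s \<otimes> (\<sigma> g (\<sigma> h t) \<otimes> c g h) \<otimes> c (g \<otimes>\<^bsub>G\<^esub> h) i"
    by (simp add: sigma_twist)
  also have "\<dots> = r \<otimes> \<sigma> g s \<otimes> \<sigma> g (\<sigma> h t) \<otimes> (c g h \<otimes> c (g \<otimes>\<^bsub>G\<^esub> h) i)"
    by (simp add: R.m_assoc)
  also have "\<dots> = r \<otimes> \<sigma> g s \<otimes> \<sigma> g (\<sigma> h t) \<otimes> (\<sigma> g (c h i) \<otimes> c g (h \<otimes>\<^bsub>G\<^esub> i))"
    by (simp add: c_cocycle)
  also have "\<dots> = r \<otimes> \<sigma> g (s \<otimes> \<sigma> h t \<otimes> c h i) \<otimes> c g (h \<otimes>\<^bsub>G\<^esub> i)"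
    by (simp add: R.m_assoc sigma_mult)
  finally show ?thesis by (simp add: cp_monom_mult G.m_assoc)
qed

text \<open>Both sides are additive in each factor, so the identity reduces to monomials: first in
  \<open>f3\<close>, then in \<open>f2\<close>, then in \<open>f1\<close>.\<close>

lemma S_assoc:
  assumes f1: "f1 \<in> carrier S" and f2: "f2 \<in> carrier S" and f3: "f3 \<in> carrier S"
  shows "(f1 \<otimes>\<^bsub>S\<^esub> f2) \<otimes>\<^bsub>S\<^esub> f3 = f1 \<otimes>\<^bsub>S\<^esub> (f2 \<otimes>\<^bsub>S\<^esub> f3)"
proof -
  have 3: "(cp_monom R g r \<otimes>\<^bsub>S\<^esub> cp_monom R h s) \<otimes>\<^bsub>S\<^esub> f3 =
      cp_monom R g r \<otimes>\<^bsub>S\<^esub> (cp_monom R h s \<otimes>\<^bsub>S\<^esub> f3)"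
    if "g \<in> carrier G" "h \<in> carrier G" "r \<in> carrier R" "s \<in> carrier R" for g h r s
    using f3 S_coeff[OF f3]
    by (induction f3 rule: S_induct)
      (use that in \<open>simp_all add: S_mult_zero S_r_distr S_closed S_assoc_monom\<close>)
  have 2: "(cp_monom R g r \<otimes>\<^bsub>S\<^esub> f2) \<otimes>\<^bsub>S\<^esub> f3 = cp_monom R g r \<otimes>\<^bsub>S\<^esub> (f2 \<otimes>\<^bsub>S\<^esub> f3)"
    if "g \<in> carrier G" "r \<in> carrier R" for g r
    using f2 S_coeff[OF f2]
    by (induction f2 rule: S_induct)
      (use that f3 in \<open>simp_all add: S_zero_mult S_mult_zero S_l_distr S_r_distr S_closed 3\<close>)
  show ?thesis
    using f1 S_coeff[OF f1]
    by (induction f1 rule: S_induct)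
      (use f2 f3 in \<open>simp_all add: S_zero_mult S_l_distr S_closed 2\<close>)
qed

lemma S_ring: "ring S"
proof (rule ringI[OF S_abelian_group])
  have "\<one>\<^bsub>S\<^esub> \<in> carrier S" by (simp add: S_one cp_monom_closed)
  moreover have "\<one>\<^bsub>S\<^esub> \<otimes>\<^bsub>S\<^esub> f = f" if f: "f \<in> carrier S" for f
    using f S_coeff[OF f]
    by (induction f rule: S_induct)
      (simp_all add: S_one S_mult_zero S_r_distr S_closed cp_monom_mult sigma_one c_one_left)
  moreover have "f \<otimes>\<^bsub>S\<^esub> \<one>\<^bsub>S\<^esub> = f" if f: "f \<in> carrier S" for f
    using f S_coeff[OF f]
    by (induction f rule: S_induct)
      (simp_all add: S_one S_zero_mult S_l_distr S_closed cp_monom_mult c_one_right)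
  ultimately show "monoid S"
    by (intro monoidI) (auto simp: S_mult_closed S_assoc)
qed (auto simp: S_l_distr S_r_distr)

text \<open>Cancellation leaves \<open>(g, k)\<close> as the only contributing pair, so no other
  coefficient of \<open>f\<close> interferes.\<close>

lemma monom_mult_coeff:
  assumes g: "g \<in> carrier G" and r: "r \<in> carrier R" and f: "f \<in> carrier S" and k: "k \<in> carrier G"
    and cancel: "\<And>y. y \<in> carrier G \<Longrightarrow> g \<otimes>\<^bsub>G\<^esub> y = g \<otimes>\<^bsub>G\<^esub> k \<Longrightarrow> y = k"
  shows "(cp_monom R g r \<otimes>\<^bsub>S\<^esub> f) (g \<otimes>\<^bsub>G\<^esub> k) = r \<otimes> \<sigma> g (f k) \<otimes> c g k"
proof -
  note [simp] = S_coeff[OF f]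
  \<comment> \<open>\<open>k\<close> is added because \<open>f k\<close> may be zero.\<close>
  let ?Y = "insert k (cp_supp R f)"
  have Y: "finite ?Y" "?Y \<subseteq> carrier G" using f k by (auto simp: S_carrier)
  have "(cp_monom R g r \<otimes>\<^bsub>S\<^esub> f) (g \<otimes>\<^bsub>G\<^esub> k) =
      finsum R (cp_term (cp_monom R g r) f) {(x, y) \<in> {g} \<times> ?Y. x \<otimes>\<^bsub>G\<^esub> y = g \<otimes>\<^bsub>G\<^esub> k}"
    by (rule S_mult_eq) (use f g r Y cp_monom_closed in \<open>auto simp: cp_supp_def cp_monom_def\<close>)
  also have "{(x, y) \<in> {g} \<times> ?Y. x \<otimes>\<^bsub>G\<^esub> y = g \<otimes>\<^bsub>G\<^esub> k} = {(g, k)}"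
    using Y cancel by auto
  finally show ?thesis using g r f k by (simp add: cp_monom_def)
qed

lemma mult_monom_coeff:
  assumes g: "g \<in> carrier G" and r: "r \<in> carrier R" and f: "f \<in> carrier S" and k: "k \<in> carrier G"
    and cancel: "\<And>y. y \<in> carrier G \<Longrightarrow> y \<otimes>\<^bsub>G\<^esub> g = k \<otimes>\<^bsub>G\<^esub> g \<Longrightarrow> y = k"
  shows "(f \<otimes>\<^bsub>S\<^esub> cp_monom R g r) (k \<otimes>\<^bsub>G\<^esub> g) = f k \<otimes> \<sigma> k r \<otimes> c k g"
proof -
  note [simp] = S_coeff[OF f]
  let ?Y = "insert k (cp_supp R f)"
  have Y: "finite ?Y" "?Y \<subseteq> carrier G" using f k by (auto simp: S_carrier)
  have "(f \<otimes>\<^bsub>S\<^esub> cp_monom R g r) (k \<otimes>\<^bsub>G\<^esub> g) =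
      finsum R (cp_term f (cp_monom R g r)) {(x, y) \<in> ?Y \<times> {g}. x \<otimes>\<^bsub>G\<^esub> y = k \<otimes>\<^bsub>G\<^esub> g}"
    by (rule S_mult_eq) (use f g r Y cp_monom_closed in \<open>auto simp: cp_supp_def cp_monom_def\<close>)
  also have "{(x, y) \<in> ?Y \<times> {g}. x \<otimes>\<^bsub>G\<^esub> y = k \<otimes>\<^bsub>G\<^esub> g} = {(k, g)}"
    using Y cancel by auto
  finally show ?thesis using g r f k by (simp add: cp_monom_def)
qed


section \<open>Extended ideals\<close>

text \<open>The concrete form of \<open>IS\<close>; see \<open>cp_extension_eq\<close>.\<close>

definition cp_coeffs :: "'r set \<Rightarrow> ('g \<Rightarrow> 'r) set" where
  "cp_coeffs J = {f \<in> carrier S. \<forall>x. f x \<in> J}"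

lemma mult_coeff_mem:
  assumes J: "ideal J R" and f: "f \<in> carrier S" "f' \<in> carrier S"
    and mem: "\<And>x y. \<lbrakk>x \<in> carrier G; y \<in> carrier G\<rbrakk> \<Longrightarrow> f x \<otimes> \<sigma> x (f' y) \<otimes> c x y \<in> J"
  shows "(f \<otimes>\<^bsub>S\<^esub> f') k \<in> J"
proof -
  let ?X = "cp_supp R f" and ?Y = "cp_supp R f'"
  have XY: "finite ?X" "?X \<subseteq> carrier G" "finite ?Y" "?Y \<subseteq> carrier G"
    using f by (auto simp: S_carrier)
  have "(f \<otimes>\<^bsub>S\<^esub> f') k = finsum R (cp_term f f') {(x, y) \<in> ?X \<times> ?Y. x \<otimes>\<^bsub>G\<^esub> y = k}"
    by (rule S_mult_eq) (use f XY in auto)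
  also have "\<dots> \<in> J"
  proof (rule ideal.finsum_mem[OF J])
    show "finite {(x, y) \<in> ?X \<times> ?Y. x \<otimes>\<^bsub>G\<^esub> y = k}"
      by (rule finite_subset[of _ "?X \<times> ?Y"]) (use XY in auto)
  qed (use mem XY in auto)
  finally show ?thesis .
qed

text \<open>Under left multiplication the coefficients of \<open>a\<close> pass through maps
  \<open>\<sigma> g\<close>, which preserve \<open>J\<close> by invariance; under right
  multiplication they are the leftmost factors of the terms, and \<open>J\<close> absorbs the
  rest.\<close>

lemma cp_coeffs_ideal:
  assumes J: "G_invariant_ideal R G \<sigma> J"
  shows "ideal (cp_coeffs J) S"
proof -
  interpret SR: ring S by (rule S_ring)
  interpret J: ideal J R using J by (simp add: G_invariant_ideal_def)
  have sig: "\<sigma> g r \<in> J" if "g \<in> carrier G" "r \<in> J" for g r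
    using J that unfolding G_invariant_ideal_def by blast
  show ?thesis
  proof (rule SR.ideal_criterion)
    fix a x assume a: "a \<in> cp_coeffs J" and x: "x \<in> carrier S"
    then have aS: "a \<in> carrier S" and aJ: "a y \<in> J" for y by (auto simp: cp_coeffs_def)
    have "(x \<otimes>\<^bsub>S\<^esub> a) k \<in> J" for k
      by (rule mult_coeff_mem[OF J.is_ideal x aS])
        (simp add: aJ sig S_coeff[OF x] J.I_l_closed J.I_r_closed)
    then show "x \<otimes>\<^bsub>S\<^esub> a \<in> cp_coeffs J" using aS x by (simp add: cp_coeffs_def)
    have "(a \<otimes>\<^bsub>S\<^esub> x) k \<in> J" for k
      by (rule mult_coeff_mem[OF J.is_ideal aS x])
        (simp add: aJ S_coeff[OF x] J.I_r_closed)
    then show "a \<otimes>\<^bsub>S\<^esub> x \<in> cp_coeffs J" using aS x by (simp add: cp_coeffs_def)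
  qed (auto simp: cp_coeffs_def S_zero_closed S_add_closed, auto simp: S_zero S_add)
qed

text \<open>For the inclusion from right to left, \<open>r u g\<close> equals
  \<open>(r u e) (1 u g)\<close> because \<open>c e g = 1\<close>, where \<open>e\<close> is the
  identity of \<open>G\<close>; every element is a sum of such monomials.\<close>

lemma cp_extension_eq:
  assumes J: "ideal J R"
  shows "cp_extension R G \<sigma> c J = cp_coeffs J"
proof
  interpret J: ideal J R by (rule J)
  show "cp_extension R G \<sigma> c J \<subseteq> cp_coeffs J"
  proof
    fix f assume "f \<in> cp_extension R G \<sigma> c J"
    then have "f \<in> (cp_embed R G ` J) \<cdot>\<^bsub>S\<^esub> carrier S" by (simp add: cp_extension_def)
    then show "f \<in> cp_coeffs J"
    proof (induction rule: ideal_prod.induct)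
      case (prod i f)
      then obtain r where r: "r \<in> J" "i = cp_monom R \<one>\<^bsub>G\<^esub> r" by (auto simp: cp_embed_def)
      have i: "i \<in> carrier S" using r by (simp add: cp_monom_closed J.Icarr)
      have iJ: "i x \<in> J" for x using r by (simp add: cp_monom_def)
      have "(i \<otimes>\<^bsub>S\<^esub> f) k \<in> J" for k
        by (rule mult_coeff_mem[OF J i prod(2)])
          (simp add: iJ S_coeff[OF prod(2)] J.I_r_closed)
      then show ?case using i prod(2) by (simp add: cp_coeffs_def S_mult_closed)
    qed (auto simp: cp_coeffs_def S_add_closed, auto simp: S_add)
  qed
  show "cp_coeffs J \<subseteq> cp_extension R G \<sigma> c J"
  proof
    fix f assume "f \<in> cp_coeffs J"
    then have f: "f \<in> carrier S" "\<And>x. f x \<in> J" by (auto simp: cp_coeffs_def)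
    have prod: "cp_monom R \<one>\<^bsub>G\<^esub> r \<otimes>\<^bsub>S\<^esub> h \<in> cp_extension R G \<sigma> c J"
      if "r \<in> J" "h \<in> carrier S" for r h
      using that by (auto simp: cp_extension_def cp_embed_def intro: ideal_prod.prod)
    show "f \<in> cp_extension R G \<sigma> c J"
      using f
    proof (induction f rule: S_induct)
      case zero
      have "cp_monom R \<one>\<^bsub>G\<^esub> \<zero> = \<zero>\<^bsub>S\<^esub>" by (auto simp: cp_monom_def S_zero)
      then show ?case
        using prod[OF J.zero_closed S_zero_closed] S_zero_mult[OF S_zero_closed] by simp
    next
      case (monom g r h)
      have "cp_monom R g r = cp_monom R \<one>\<^bsub>G\<^esub> r \<otimes>\<^bsub>S\<^esub> cp_monom R g \<one>"
        using monom by (simp add: cp_monom_mult c_one_left)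
      also have "\<dots> \<in> cp_extension R G \<sigma> c J"
        by (rule prod) (use monom in \<open>auto intro: cp_monom_closed\<close>)
      finally show ?case using monom unfolding cp_extension_def by (intro ideal_prod.sum)
    qed
  qed
qed

lemma cp_coeffs_mono_iff:
  assumes "J \<subseteq> carrier R" "\<zero> \<in> J" "\<zero> \<in> I"
  shows "cp_coeffs J \<subseteq> cp_coeffs I \<longleftrightarrow> J \<subseteq> I"
proof
  assume sub: "cp_coeffs J \<subseteq> cp_coeffs I"
  show "J \<subseteq> I"
  proof
    fix r assume r: "r \<in> J"
    then have "cp_monom R \<one>\<^bsub>G\<^esub> r \<in> cp_coeffs J"
      using assms by (auto simp: cp_coeffs_def cp_monom_closed) (auto simp: cp_monom_def)
    then have "cp_monom R \<one>\<^bsub>G\<^esub> r \<one>\<^bsub>G\<^esub> \<in> I"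
      using sub by (auto simp: cp_coeffs_def)
    then show "r \<in> I" by (simp add: cp_monom_def)
  qed
qed (auto simp: cp_coeffs_def)

lemma cp_coeffs_eq_carrier_iff:
  assumes I: "ideal I R"
  shows "cp_coeffs I = carrier S \<longleftrightarrow> I = carrier R"
proof -
  interpret I: ideal I R by (rule I)
  have "cp_coeffs (carrier R) = carrier S" by (auto simp: cp_coeffs_def S_coeff)
  moreover have "I = carrier R" if "cp_coeffs I = cp_coeffs (carrier R)"
    using that cp_coeffs_mono_iff[of "carrier R" I] I.Icarr by auto
  ultimately show ?thesis by auto
qed

text \<open>Each term of a product starts with \<open>f x \<otimes> \<sigma> x (f' y)\<close>, a
  product from \<open>J\<close> and \<open>K\<close> because \<open>K\<close> is stable under
  \<open>\<sigma> x\<close>. This carries the forward implication.\<close>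

lemma cp_coeffs_prod:
  assumes J: "ideal J R" and K: "G_invariant_ideal R G \<sigma> K" and I: "ideal I R"
    and sub: "J \<cdot>\<^bsub>R\<^esub> K \<subseteq> I"
  shows "cp_coeffs J \<cdot>\<^bsub>S\<^esub> cp_coeffs K \<subseteq> cp_coeffs I"
proof
  interpret I: ideal I R by (rule I)
  have sig: "\<sigma> g r \<in> K" if "g \<in> carrier G" "r \<in> K" for g r
    using K that unfolding G_invariant_ideal_def by blast
  fix f assume "f \<in> cp_coeffs J \<cdot>\<^bsub>S\<^esub> cp_coeffs K"
  then show "f \<in> cp_coeffs I"
  proof (induction rule: ideal_prod.induct)
    case (prod f f')
    then have f: "f \<in> carrier S" "f' \<in> carrier S" and mem: "f x \<in> J" "f' x \<in> K" for x
      by (auto simp: cp_coeffs_def)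
    have "f x \<otimes> \<sigma> x (f' y) \<in> I" if "x \<in> carrier G" for x y
      using sub ideal_prod.prod[OF mem(1) sig[OF that mem(2)]] by blast
    then have "(f \<otimes>\<^bsub>S\<^esub> f') k \<in> I" for k
      by (intro mult_coeff_mem[OF I f]) (simp add: I.I_r_closed)
    then show ?case using f by (simp add: cp_coeffs_def S_mult_closed)
  qed (auto simp: cp_coeffs_def S_add_closed, auto simp: S_add)
qed

end

section \<open>Annihilators modulo an ideal\<close>

text \<open>For an ideal \<open>I\<close>, the free middle factor \<open>r\<close> makes this the
  right annihilator, modulo \<open>I\<close>, of the two-sided ideal generated by \<open>A\<close>,
  hence itself a two-sided ideal.\<close>

definition annih_r :: "('r, 'm) ring_scheme \<Rightarrow> 'r set \<Rightarrow> 'r set \<Rightarrow> 'r set" where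
  "annih_r R I A = {t \<in> carrier R. \<forall>a\<in>A. \<forall>r\<in>carrier R. a \<otimes>\<^bsub>R\<^esub> r \<otimes>\<^bsub>R\<^esub> t \<in> I}"

definition annih_l :: "('r, 'm) ring_scheme \<Rightarrow> 'r set \<Rightarrow> 'r set \<Rightarrow> 'r set" where
  "annih_l R I A = {t \<in> carrier R. \<forall>a\<in>A. \<forall>r\<in>carrier R. t \<otimes>\<^bsub>R\<^esub> r \<otimes>\<^bsub>R\<^esub> a \<in> I}"

context ideal
begin

lemma annih_r_ideal:
  assumes A: "A \<subseteq> carrier R"
  shows "ideal (annih_r R I A) R"
proof (rule ideal_criterion)
  fix t x assume t: "t \<in> annih_r R I A" and x: "x \<in> carrier R"
  then have tR: "t \<in> carrier R" and tA: "a \<otimes> r \<otimes> t \<in> I" if "a \<in> A" "r \<in> carrier R" for a r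
    using that by (auto simp: annih_r_def)
  have "a \<otimes> r \<otimes> (x \<otimes> t) \<in> I" if "a \<in> A" "r \<in> carrier R" for a r
    using tA[OF that(1), of "r \<otimes> x"] that x t A by (auto simp: m_assoc annih_r_def subset_iff)
  then show "x \<otimes> t \<in> annih_r R I A" using t x by (auto simp: annih_r_def)
  have "a \<otimes> r \<otimes> (t \<otimes> x) \<in> I" if "a \<in> A" "r \<in> carrier R" for a r
    using I_r_closed[OF tA[OF that] x] that x t A by (auto simp: m_assoc annih_r_def subset_iff)
  then show "t \<otimes> x \<in> annih_r R I A" using t x by (auto simp: annih_r_def)
qed (use A in \<open>auto simp: annih_r_def r_distr subset_iff\<close>)

lemma annih_l_ideal:
  assumes A: "A \<subseteq> carrier R"
  shows "ideal (annih_l R I A) R"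
proof (rule ideal_criterion)
  fix t x assume t: "t \<in> annih_l R I A" and x: "x \<in> carrier R"
  then have tA: "t \<otimes> r \<otimes> a \<in> I" if "a \<in> A" "r \<in> carrier R" for a r
    using that by (auto simp: annih_l_def)
  have "x \<otimes> t \<otimes> r \<otimes> a \<in> I" if "a \<in> A" "r \<in> carrier R" for a r
    using I_l_closed[OF tA[OF that] x] that x t A by (auto simp: m_assoc annih_l_def subset_iff)
  then show "x \<otimes> t \<in> annih_l R I A" using t x by (auto simp: annih_l_def)
  have "t \<otimes> x \<otimes> r \<otimes> a \<in> I" if "a \<in> A" "r \<in> carrier R" for a r
    using tA[OF that(1), of "x \<otimes> r"] that x t A by (auto simp: m_assoc annih_l_def subset_iff)
  then show "t \<otimes> x \<in> annih_l R I A" using t x by (auto simp: annih_l_def)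
qed (use A in \<open>auto simp: annih_l_def l_distr subset_iff\<close>)

lemma annih_l_prod:
  assumes "A \<subseteq> carrier R"
  shows "annih_l R I A \<cdot>\<^bsub>R\<^esub> A \<subseteq> I"
proof
  fix x assume "x \<in> annih_l R I A \<cdot>\<^bsub>R\<^esub> A"
  then show "x \<in> I"
  proof (induction rule: ideal_prod.induct)
    case (prod t a)
    then have "t \<in> carrier R" "\<forall>r\<in>carrier R. t \<otimes> r \<otimes> a \<in> I" by (auto simp: annih_l_def)
    from this(1) bspec[OF this(2) one_closed] show ?case by simp
  qed simp
qed

text \<open>Multiplying \<open>u \<otimes> r \<otimes> t\<close> on the left keeps it in
  \<open>I\<close>. If the annihilator of \<open>u\<close> is maximal, then
  \<open>a \<otimes> s \<otimes> u\<close> has the same annihilator as soon as it lies outside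
  \<open>I\<close>.\<close>

lemma annih_r_mult:
  assumes a: "a \<in> carrier R" "s \<in> carrier R" and u: "u \<in> carrier R"
  shows "annih_r R I {u} \<subseteq> annih_r R I {a \<otimes> s \<otimes> u}"
proof
  fix t assume t: "t \<in> annih_r R I {u}"
  then have "u \<otimes> r \<otimes> t \<in> I" if "r \<in> carrier R" for r
    using that by (simp add: annih_r_def)
  then have "(a \<otimes> s) \<otimes> (u \<otimes> r \<otimes> t) \<in> I" if "r \<in> carrier R" for r
    using that a by (simp add: I_l_closed)
  then show "t \<in> annih_r R I {a \<otimes> s \<otimes> u}" using t a u by (auto simp: annih_r_def m_assoc)
qed

end

text \<open>If every member had a strictly larger one in the family, dependent choice would give a
  strictly increasing chain of ideals.\<close>

lemma acc_on_ideals_maximal: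
  assumes acc: "acc_on_ideals R" and ne: "\<C> \<noteq> {}" and id: "\<And>J. J \<in> \<C> \<Longrightarrow> ideal J R"
  obtains M where "M \<in> \<C>" "\<And>J. \<lbrakk>J \<in> \<C>; M \<subseteq> J\<rbrakk> \<Longrightarrow> J = M"
proof (rule ccontr)
  assume "\<not> thesis"
  then have *: "\<forall>M\<in>\<C>. \<exists>J. J \<in> \<C> \<and> M \<subset> J"
    using that by blast
  have "\<exists>C. \<forall>n::nat. C n \<in> \<C> \<and> C n \<subset> C (Suc n)"
    by (rule dependent_nat_choice) (use ne * in auto)
  then obtain C where C: "\<And>n::nat. C n \<in> \<C>" "\<And>n. C n \<subset> C (Suc n)" by blast
  then obtain n where "\<forall>m\<ge>n. C m = C n"
    using acc id unfolding acc_on_ideals_def by (metis psubset_imp_subset)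
  then show False using C(2)[of n] by (metis le_Suc_eq order_refl psubset_eq)
qed

text \<open>If \<open>y\<close> and \<open>z\<close> differed, the sets \<open>{x}\<close> and
  \<open>{y, z}\<close> would have only two coinciding products and no unique one.\<close>

lemma unique_product_monoid_cancel:
  assumes G: "unique_product_monoid G" and x: "x \<in> carrier G" "y \<in> carrier G" "z \<in> carrier G"
  shows "x \<otimes>\<^bsub>G\<^esub> y = x \<otimes>\<^bsub>G\<^esub> z \<Longrightarrow> y = z"
    and "y \<otimes>\<^bsub>G\<^esub> x = z \<otimes>\<^bsub>G\<^esub> x \<Longrightarrow> y = z"
proof -
  have up: "\<exists>x\<in>X. \<exists>y\<in>Y. \<forall>x'\<in>X. \<forall>y'\<in>Y. (x', y') \<noteq> (x, y) \<longrightarrow> x \<otimes>\<^bsub>G\<^esub> y \<noteq> x' \<otimes>\<^bsub>G\<^esub> y'"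
    if "finite X" "X \<noteq> {}" "X \<subseteq> carrier G" "finite Y" "Y \<noteq> {}" "Y \<subseteq> carrier G" for X Y
    using G that unfolding unique_product_monoid_def by blast
  show "y = z" if "x \<otimes>\<^bsub>G\<^esub> y = x \<otimes>\<^bsub>G\<^esub> z"
    using up[of "{x}" "{y, z}"] x that by fastforce
  show "y = z" if "y \<otimes>\<^bsub>G\<^esub> x = z \<otimes>\<^bsub>G\<^esub> x"
    using up[of "{y, z}" "{x}"] x that by fastforce
qed

section \<open>Surjective crossed systems over rings with ACC\<close>

locale acc_crossed_system = crossed_system +
  assumes acc: "acc_on_ideals R"
    and sigma_surj: "g \<in> carrier G \<Longrightarrow> \<sigma> g ` carrier R = carrier R"
begin

lemma sigma_surjE:
  assumes "g \<in> carrier G" "r \<in> carrier R"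
  obtains s where "s \<in> carrier R" "r = \<sigma> g s"
  using sigma_surj assms by (metis imageE)

lemma sigma_vimage_ideal:
  assumes g: "g \<in> carrier G" and J: "ideal J R"
  shows "ideal {r \<in> carrier R. \<sigma> g r \<in> J} R"
proof -
  interpret J: ideal J R by (rule J)
  show ?thesis
    by (rule R.ideal_criterion)
      (use g in \<open>auto simp: sigma_add sigma_mult J.I_l_closed J.I_r_closed\<close>)
qed

text \<open>Since \<open>\<sigma> g\<close> is surjective, \<open>\<sigma> g\<inverse>\<close> is injective on subsets of the ring, so the chain
  \<open>T \<subseteq> \<sigma> g\<inverse> T \<subseteq> \<sigma> g\<inverse> (\<sigma> g\<inverse> T) \<subseteq> \<dots>\<close> becomes stationary only if it is constant.\<close>

lemma sigma_vimage_eq: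
  assumes g: "g \<in> carrier G" and T: "ideal T R" and sub: "\<And>r. r \<in> T \<Longrightarrow> \<sigma> g r \<in> T"
  shows "{r \<in> carrier R. \<sigma> g r \<in> T} = T"
proof -
  define pre where "pre J = {r \<in> carrier R. \<sigma> g r \<in> J}" for J
  define D where "D n = (pre ^^ n) T" for n
  have D_Suc: "D (Suc n) = pre (D n)" for n by (simp add: D_def)
  have Did: "ideal (D n) R" for n
  proof (induction n)
    case (Suc n)
    then show ?case unfolding D_Suc pre_def by (rule sigma_vimage_ideal[OF g])
  qed (simp add: D_def T)
  have DR: "D n \<subseteq> carrier R" for n using ideal.Icarr[OF Did] by blast
  have mono: "D n \<subseteq> D (Suc n)" for n
  proof (induction n)
    case 0
    show ?case using sub ideal.Icarr[OF T] by (auto simp: D_def pre_def)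
  next
    case (Suc n)
    then show ?case unfolding D_Suc by (auto simp: pre_def)
  qed
  obtain n where "\<forall>m\<ge>n. D m = D n"
    using spec[OF acc[unfolded acc_on_ideals_def], of D] Did mono by blast
  then have "D (Suc n) = D n" using le_SucI[OF order_refl] by blast
  moreover have pre_inj: "A = B" if "pre A = pre B" "A \<subseteq> carrier R" "B \<subseteq> carrier R" for A B
  proof -
    have "\<sigma> g ` pre C = C" if C: "C \<subseteq> carrier R" for C
      using C sigma_surj[OF g] by (fastforce simp: pre_def)
    then show ?thesis using that by metis
  qed
  have "D (Suc n) = D n \<Longrightarrow> D 1 = D 0" for n
  proof (induction n)
    case (Suc n)
    then have "pre (D (Suc n)) = pre (D n)" by (metis D_Suc)
    then have "D (Suc n) = D n" by (rule pre_inj[OF _ DR DR])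
    then show ?case by (rule Suc.IH)
  qed simp
  ultimately show ?thesis by (simp add: D_def pre_def)
qed

text \<open>The reverse inclusion in the definition of invariance follows from
  \<open>sigma_vimage_eq\<close>. Invariance of the ideals built below is checked in this
  form.\<close>

lemma G_invariant_idealI:
  assumes "ideal T R" "\<And>g r. \<lbrakk>g \<in> carrier G; r \<in> T\<rbrakk> \<Longrightarrow> \<sigma> g r \<in> T"
  shows "G_invariant_ideal R G \<sigma> T"
  using assms sigma_vimage_eq by (simp add: G_invariant_ideal_def)

text \<open>The twist relation, solved for the composite by means of the inverse unit:
  \<open>\<sigma>\<close> respects products in \<open>G\<close> up to inner automorphisms.\<close>

lemma sigma_mult_conj:
  assumes "g \<in> carrier G" "h \<in> carrier G" "r \<in> carrier R"
  shows "\<sigma> g (\<sigma> h r) = c g h \<otimes> \<sigma> (g \<otimes>\<^bsub>G\<^esub> h) r \<otimes> inv c g h"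
proof -
  have u: "c g h \<in> Units R" using assms by (simp add: c_unit)
  have "\<sigma> g (\<sigma> h r) = \<sigma> g (\<sigma> h r) \<otimes> c g h \<otimes> inv c g h"
    using assms u by (simp add: R.m_assoc R.Units_closed)
  then show ?thesis using assms by (simp add: sigma_twist)
qed

text \<open>Two-sided ideals are stable under the conjugation in \<open>sigma_mult_conj\<close>.
  This stands in for an action law when orbits are considered modulo an ideal.\<close>

lemma sigma_mult_mem:
  assumes "ideal J R" "g \<in> carrier G" "h \<in> carrier G" "r \<in> carrier R" "\<sigma> (g \<otimes>\<^bsub>G\<^esub> h) r \<in> J"
  shows "\<sigma> g (\<sigma> h r) \<in> J"
  using assms c_unit[of g h]
  by (simp add: sigma_mult_conj ideal.I_l_closed ideal.I_r_closed)

end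

section \<open>Invariant ideals and their annihilators\<close>

locale invariant_ideal = acc_crossed_system +
  fixes I
  assumes inv: "G_invariant_ideal R G \<sigma> I"
begin

lemma I_ideal: "ideal I R"
  using inv by (simp add: G_invariant_ideal_def)

sublocale I: ideal I R by (rule I_ideal)

lemma I_sigma_iff: "g \<in> carrier G \<Longrightarrow> r \<in> carrier R \<Longrightarrow> \<sigma> g r \<in> I \<longleftrightarrow> r \<in> I"
  using inv unfolding G_invariant_ideal_def by blast

lemma I_mult_unit_iff:
  assumes "r \<in> carrier R" "u \<in> Units R"
  shows "r \<otimes> u \<in> I \<longleftrightarrow> r \<in> I"
proof
  assume "r \<otimes> u \<in> I"
  then have "r \<otimes> u \<otimes> inv u \<in> I" using assms by (simp add: I.I_r_closed)
  then show "r \<in> I" using assms by (simp add: R.m_assoc R.Units_closed)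
qed (use assms in \<open>simp add: I.I_r_closed R.Units_closed\<close>)

lemma annih_l_invariant:
  assumes V: "G_invariant_ideal R G \<sigma> V"
  shows "G_invariant_ideal R G \<sigma> (annih_l R I V)"
proof (rule G_invariant_idealI)
  have VR: "V \<subseteq> carrier R"
    using V ideal.Icarr unfolding G_invariant_ideal_def by blast
  then show "ideal (annih_l R I V) R" by (rule I.annih_l_ideal)
  fix g w assume g: "g \<in> carrier G" and w: "w \<in> annih_l R I V"
  then have wR: "w \<in> carrier R" by (simp add: annih_l_def)
  have "\<sigma> g w \<otimes> r \<otimes> v \<in> I" if v: "v \<in> V" and r: "r \<in> carrier R" for v r
  proof -
    \<comment> \<open>Pulling \<open>v\<close> and \<open>r\<close> back through
      \<open>\<sigma> g\<close> makes the product in question the image of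
      \<open>w \<otimes> r' \<otimes> v'\<close>. The preimage \<open>v'\<close> lies in
      \<open>V\<close> because invariance also works backwards.\<close>
    obtain v' where v': "v' \<in> carrier R" "v = \<sigma> g v'" using sigma_surjE g v VR by blast
    obtain r' where r': "r' \<in> carrier R" "r = \<sigma> g r'" using sigma_surjE g r by blast
    have "v' \<in> V" using V g v v' unfolding G_invariant_ideal_def by blast
    then have "\<sigma> g (w \<otimes> r' \<otimes> v') \<in> I"
      using w g r' v' wR by (simp add: I_sigma_iff annih_l_def)
    then show ?thesis using g v' r' wR by (simp add: sigma_mult)
  qed
  then show "\<sigma> g w \<in> annih_l R I V" using g wR by (simp add: annih_l_def)
qed

end

section \<open>Ideals that are prime with respect to invariant ideals\<close>

locale G_prime_ideal = invariant_ideal +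
  assumes G_prime: "\<lbrakk>G_invariant_ideal R G \<sigma> J; G_invariant_ideal R G \<sigma> K; J \<cdot>\<^bsub>R\<^esub> K \<subseteq> I\<rbrakk>
      \<Longrightarrow> J \<subseteq> I \<or> K \<subseteq> I"
begin

text \<open>Otherwise \<open>b\<close> lies in the set \<open>V\<close> of elements whose whole
  orbit is in \<open>annih_r R I {u}\<close>. \<open>V\<close> is an invariant ideal and
  \<open>u\<close> annihilates it from the left modulo \<open>I\<close>, so primeness applied to
  \<open>annih_l R I V\<close> and \<open>V\<close> puts \<open>u\<close> or \<open>b\<close> into
  \<open>I\<close>.\<close>

lemma sigma_orbit_not_annihilated:
  assumes u: "u \<in> carrier R" "u \<notin> I" and b: "b \<in> carrier R" "b \<notin> I"
  obtains g where "g \<in> carrier G" "\<sigma> g b \<notin> annih_r R I {u}"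
proof (rule ccontr)
  assume neg: "\<not> thesis"
  define P where "P = annih_r R I {u}"
  interpret P: ideal P R unfolding P_def by (rule I.annih_r_ideal) (use u in simp)
  define V where "V = {x \<in> carrier R. \<forall>g\<in>carrier G. \<sigma> g x \<in> P}"
  have VR: "V \<subseteq> carrier R" by (auto simp: V_def)
  have "ideal V R"
    by (rule R.ideal_criterion)
      (auto simp: V_def sigma_add sigma_mult P.I_l_closed P.I_r_closed)
  then have V: "G_invariant_ideal R G \<sigma> V"
    by (rule G_invariant_idealI) (auto simp: V_def intro: sigma_mult_mem[OF P.is_ideal])
  have VP: "V \<subseteq> P" by (auto simp: V_def sigma_one dest: bspec[OF _ G.one_closed])
  have "u \<otimes> r \<otimes> v \<in> I" if "v \<in> V" "r \<in> carrier R" for v r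
    using subsetD[OF VP that(1)] that(2) unfolding P_def annih_r_def by blast
  then have "u \<in> annih_l R I V" using u by (simp add: annih_l_def)
  then have "V \<subseteq> I"
    using G_prime[OF annih_l_invariant[OF V] V I.annih_l_prod[OF VR]] u by blast
  moreover have "b \<in> V" using neg b that unfolding V_def P_def by blast
  ultimately show False using b by blast
qed

text \<open>Otherwise \<open>a\<close> annihilates, modulo \<open>I\<close>, the ideal
  \<open>T\<close> generated by the orbit of \<open>u\<close>. \<open>T\<close> is invariant, so
  primeness applied to \<open>annih_l R I T\<close> and \<open>T\<close> puts \<open>a\<close> or
  \<open>u\<close> into \<open>I\<close>.\<close>

lemma sigma_orbit_not_annihilating:
  assumes u: "u \<in> carrier R" "u \<notin> I" and a: "a \<in> carrier R" "a \<notin> I"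
  obtains g where "g \<in> carrier G" "\<sigma> g u \<notin> annih_r R I {a}"
proof (rule ccontr)
  assume neg: "\<not> thesis"
  define U where "U = (\<lambda>g. \<sigma> g u) ` carrier G"
  define T where "T = Idl U"
  have UR: "U \<subseteq> carrier R" using u by (auto simp: U_def)
  have Tid: "ideal T R" unfolding T_def by (rule R.genideal_ideal[OF UR])
  have UT: "U \<subseteq> T" unfolding T_def by (rule R.genideal_self[OF UR])
  have TR: "T \<subseteq> carrier R" using ideal.Icarr[OF Tid] by blast
  have T: "G_invariant_ideal R G \<sigma> T"
  proof (rule G_invariant_idealI[OF Tid])
    fix h t assume h: "h \<in> carrier G" and t: "t \<in> T"
    \<comment> \<open>The preimage of \<open>T\<close> under \<open>\<sigma> h\<close> is an ideal,
      so it contains \<open>T\<close> once it contains the generators; and \<open>\<sigma> h\<close>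
      sends a generator to a conjugate of another generator.\<close>
    have "U \<subseteq> {r \<in> carrier R. \<sigma> h r \<in> T}"
      using UT u h by (auto simp: U_def intro!: sigma_mult_mem[OF Tid])
    then have "T \<subseteq> {r \<in> carrier R. \<sigma> h r \<in> T}"
      unfolding T_def by (intro R.genideal_minimal sigma_vimage_ideal h Tid[unfolded T_def])
    then show "\<sigma> h t \<in> T" using t by blast
  qed
  have "U \<subseteq> annih_r R I {a}" using neg that by (auto simp: U_def)
  then have "T \<subseteq> annih_r R I {a}"
    unfolding T_def using I.annih_r_ideal[of "{a}"] a by (intro R.genideal_minimal) auto
  then have "a \<otimes> r \<otimes> t \<in> I" if "t \<in> T" "r \<in> carrier R" for t r
    using that unfolding annih_r_def by blast
  then have "a \<in> annih_l R I T" using a by (simp add: annih_l_def)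
  moreover have "u = \<sigma> \<one>\<^bsub>G\<^esub> u" using u by (simp add: sigma_one)
  then have "u \<in> T" using UT by (auto simp: U_def)
  ultimately show False
    using G_prime[OF annih_l_invariant[OF T] T I.annih_l_prod[OF TR]] u a by blast
qed

lemma obtain_maximal_annihilator:
  assumes "I \<noteq> carrier R"
  obtains u where "u \<in> carrier R" "u \<notin> I"
    "\<And>v. \<lbrakk>v \<in> carrier R; v \<notin> I; annih_r R I {u} \<subseteq> annih_r R I {v}\<rbrakk>
      \<Longrightarrow> annih_r R I {v} = annih_r R I {u}"
proof -
  let ?C = "(\<lambda>u. annih_r R I {u}) ` (carrier R - I)"
  have "?C \<noteq> {}" using assms I.Icarr by blast
  moreover have "ideal J R" if "J \<in> ?C" for J using that I.annih_r_ideal by auto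
  ultimately obtain M where M: "M \<in> ?C" and max: "\<And>J. \<lbrakk>J \<in> ?C; M \<subseteq> J\<rbrakk> \<Longrightarrow> J = M"
    using acc_on_ideals_maximal[OF acc, of ?C] by metis
  then obtain u where u: "u \<in> carrier R" "u \<notin> I" "M = annih_r R I {u}" by blast
  show thesis
    by (rule that[OF u(1,2)]) (rule max[unfolded u(3)], simp_all)
qed

lemma cp_coeffs_prime:
  assumes UP: "unique_product_monoid G" and proper: "I \<noteq> carrier R"
    and A: "ideal A S" and B: "ideal B S" and AB: "A \<cdot>\<^bsub>S\<^esub> B \<subseteq> cp_coeffs I"
  shows "A \<subseteq> cp_coeffs I \<or> B \<subseteq> cp_coeffs I"
proof (rule ccontr)
  assume neg: "\<not> (A \<subseteq> cp_coeffs I \<or> B \<subseteq> cp_coeffs I)"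
  interpret A: ideal A S by (rule A)
  interpret B: ideal B S by (rule B)
  have outside: "f x \<notin> I \<Longrightarrow> f \<in> carrier S \<Longrightarrow> x \<in> carrier G" for f x
    using I.zero_closed by (auto simp: S_carrier cp_supp_def)
  obtain u where u: "u \<in> carrier R" "u \<notin> I"
    and max: "\<And>v. \<lbrakk>v \<in> carrier R; v \<notin> I; annih_r R I {u} \<subseteq> annih_r R I {v}\<rbrakk>
      \<Longrightarrow> annih_r R I {v} = annih_r R I {u}"
    using obtain_maximal_annihilator[OF proper] by blast
  define P where "P = annih_r R I {u}"
  interpret P: ideal P R unfolding P_def by (rule I.annih_r_ideal) (use u in simp)

  obtain \<beta> y1 where \<beta>: "\<beta> \<in> B" "\<beta> y1 \<notin> I" using neg B.Icarr by (auto simp: cp_coeffs_def)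
  have \<beta>S: "\<beta> \<in> carrier S" using \<beta> by (simp add: B.Icarr)
  have y1: "y1 \<in> carrier G" using outside[OF \<beta>(2) \<beta>S] .
  obtain h where h: "h \<in> carrier G" "\<sigma> h (\<beta> y1) \<notin> P"
    using sigma_orbit_not_annihilated[OF u S_coeff[OF \<beta>S] \<beta>(2)] unfolding P_def by blast
  \<comment> \<open>Left multiplication by the basis element of \<open>h\<close> places
    \<open>\<sigma> h (\<beta> y1)\<close>, up to the unit \<open>c h y1\<close>, at the index
    \<open>h y1\<close>; cancellation in \<open>G\<close> keeps other terms away. This makes
    \<open>Y\<close> below nonempty.\<close>
  define b where "b = cp_monom R h \<one> \<otimes>\<^bsub>S\<^esub> \<beta>"
  have b: "b \<in> B" using \<beta> h by (simp add: b_def B.I_l_closed cp_monom_closed)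
  have bS: "b \<in> carrier S" using b by (rule B.Icarr)
  have "b (h \<otimes>\<^bsub>G\<^esub> y1) = \<one> \<otimes> \<sigma> h (\<beta> y1) \<otimes> c h y1"
    unfolding b_def
    by (rule monom_mult_coeff[OF h(1) R.one_closed \<beta>S y1])
      (rule unique_product_monoid_cancel(1)[OF UP h(1) _ y1])
  then have b_eq: "b (h \<otimes>\<^bsub>G\<^esub> y1) = \<sigma> h (\<beta> y1) \<otimes> c h y1"
    using h S_coeff[OF \<beta>S] by simp
  define Y where "Y = {y \<in> carrier G. b y \<notin> P}"
  have "h \<otimes>\<^bsub>G\<^esub> y1 \<in> Y"
  proof -
    have "b (h \<otimes>\<^bsub>G\<^esub> y1) \<otimes> inv c h y1 = \<sigma> h (\<beta> y1)"
      using h y1 S_coeff[OF \<beta>S] c_unit[of h y1] by (simp add: b_eq R.m_assoc)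
    then have "b (h \<otimes>\<^bsub>G\<^esub> y1) \<notin> P"
      using h P.I_r_closed c_unit[of h y1] y1 by (metis R.Units_inv_closed)
    then show ?thesis using h y1 by (simp add: Y_def)
  qed
  \<comment> \<open>Zero lies in \<open>P\<close>, so \<open>Y\<close> is contained in the finite
    support.\<close>
  moreover have "Y \<subseteq> cp_supp R b" by (auto simp: Y_def cp_supp_def)
  ultimately have Y: "finite Y" "Y \<noteq> {}" "Y \<subseteq> carrier G"
    using bS by (auto simp: S_carrier Y_def intro: finite_subset)

  obtain \<alpha> x1 where \<alpha>: "\<alpha> \<in> A" "\<alpha> x1 \<notin> I" using neg A.Icarr by (auto simp: cp_coeffs_def)
  have \<alpha>S: "\<alpha> \<in> carrier S" using \<alpha> by (simp add: A.Icarr)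
  have x1: "x1 \<in> carrier G" using outside[OF \<alpha>(2) \<alpha>S] .
  \<comment> \<open>The element \<open>\<sigma> (x1 g) u\<close>, which decides whether
    \<open>x1 g\<close> is in \<open>X\<close>, is conjugate to
    \<open>\<sigma> x1 (\<sigma> g u)\<close>. Hence \<open>g\<close> is chosen for a preimage
    \<open>a1\<close> of \<open>\<alpha> x1\<close>, and the relation is then transported by
    \<open>\<sigma> x1\<close>.\<close>
  obtain a1 where a1: "a1 \<in> carrier R" "\<alpha> x1 = \<sigma> x1 a1"
    using sigma_surjE[OF x1 S_coeff[OF \<alpha>S]] by blast
  have "a1 \<notin> I" using \<alpha>(2) a1 x1 I_sigma_iff by simp
  then obtain g where g: "g \<in> carrier G" "\<sigma> g u \<notin> annih_r R I {a1}"
    using sigma_orbit_not_annihilating[OF u a1(1)] by blast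
  then obtain s where s: "s \<in> carrier R" "a1 \<otimes> s \<otimes> \<sigma> g u \<notin> I"
    using u by (auto simp: annih_r_def)
  define a where "a = \<alpha> \<otimes>\<^bsub>S\<^esub> cp_monom R g \<one>"
  have a: "a \<in> A" using \<alpha> g by (simp add: a_def A.I_r_closed cp_monom_closed)
  have aS: "a \<in> carrier S" using a by (rule A.Icarr)
  have "a (x1 \<otimes>\<^bsub>G\<^esub> g) = \<alpha> x1 \<otimes> \<sigma> x1 \<one> \<otimes> c x1 g"
    unfolding a_def
    by (rule mult_monom_coeff[OF g(1) R.one_closed \<alpha>S x1])
      (rule unique_product_monoid_cancel(2)[OF UP g(1) _ x1])
  then have a_eq: "a (x1 \<otimes>\<^bsub>G\<^esub> g) = \<sigma> x1 a1 \<otimes> c x1 g"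
    using x1 a1 by simp
  define X where "X = {x \<in> carrier G. \<sigma> x u \<notin> annih_r R I {a x}}"
  have "x1 \<otimes>\<^bsub>G\<^esub> g \<in> X"
  proof (rule ccontr)
    let ?Q = "annih_r R I {a (x1 \<otimes>\<^bsub>G\<^esub> g)}"
    assume "x1 \<otimes>\<^bsub>G\<^esub> g \<notin> X"
    then have "\<sigma> (x1 \<otimes>\<^bsub>G\<^esub> g) u \<in> ?Q" using x1 g by (simp add: X_def)
    moreover have "ideal ?Q R" using S_coeff[OF aS] by (simp add: I.annih_r_ideal)
    ultimately have "\<sigma> x1 (\<sigma> g u) \<in> ?Q" using x1 g u by (simp add: sigma_mult_mem)
    moreover have cu: "c x1 g \<in> Units R" using x1 g by (simp add: c_unit)
    \<comment> \<open>This middle factor cancels the unit in \<open>a_eq\<close>, and the product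
      becomes \<open>\<sigma> x1 (a1 \<otimes> s \<otimes> \<sigma> g u)\<close>, which is outside
      \<open>I\<close> by the choice of \<open>s\<close> and invariance.\<close>
    moreover have "inv c x1 g \<otimes> \<sigma> x1 s \<in> carrier R" using x1 s cu by simp
    ultimately have "a (x1 \<otimes>\<^bsub>G\<^esub> g) \<otimes> (inv c x1 g \<otimes> \<sigma> x1 s) \<otimes> \<sigma> x1 (\<sigma> g u) \<in> I"
      unfolding annih_r_def by blast
    also have "a (x1 \<otimes>\<^bsub>G\<^esub> g) \<otimes> (inv c x1 g \<otimes> \<sigma> x1 s) = \<sigma> x1 a1 \<otimes> (c x1 g \<otimes> inv c x1 g) \<otimes> \<sigma> x1 s"
      using x1 g s a1 cu R.Units_inv_closed[OF cu] R.Units_closed[OF cu]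
      by (simp add: a_eq R.m_assoc del: R.Units_r_inv)
    also have "\<dots> = \<sigma> x1 (a1 \<otimes> s)" using x1 s a1 cu by (simp add: sigma_mult)
    also have "\<sigma> x1 (a1 \<otimes> s) \<otimes> \<sigma> x1 (\<sigma> g u) = \<sigma> x1 (a1 \<otimes> s \<otimes> \<sigma> g u)"
      using x1 s a1 g u by (simp add: sigma_mult)
    finally show False using s(2) a1 s x1 g u by (simp add: I_sigma_iff)
  qed
  moreover have "X \<subseteq> cp_supp R a" using u by (auto simp: X_def cp_supp_def annih_r_def)
  ultimately have X: "finite X" "X \<noteq> {}" "X \<subseteq> carrier G"
    using aS by (auto simp: S_carrier X_def intro: finite_subset)

  obtain x0 y0 where x0: "x0 \<in> X" and y0: "y0 \<in> Y"
    and uniq: "\<And>x y. \<lbrakk>x \<in> X; y \<in> Y; x \<otimes>\<^bsub>G\<^esub> y = x0 \<otimes>\<^bsub>G\<^esub> y0\<rbrakk> \<Longrightarrow> x = x0 \<and> y = y0"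
    using UP X Y unfolding unique_product_monoid_def by (metis prod.inject)
  have x0G: "x0 \<in> carrier G" and y0G: "y0 \<in> carrier G" using x0 y0 X Y by auto
  \<comment> \<open>Both \<open>a x0\<close> and the middle factor \<open>t'\<close> are written as
    images under \<open>\<sigma> x0\<close>, so that invariance of \<open>I\<close> strips off
    \<open>\<sigma> x0\<close> and leaves \<open>a0 \<otimes> t \<otimes> u\<close> outside
    \<open>I\<close>.\<close>
  obtain a0 where a0: "a0 \<in> carrier R" "a x0 = \<sigma> x0 a0"
    using sigma_surjE[OF x0G S_coeff[OF aS]] by blast
  obtain t' where t': "t' \<in> carrier R" "a x0 \<otimes> t' \<otimes> \<sigma> x0 u \<notin> I"
    using x0 u by (auto simp: X_def annih_r_def)
  obtain t where t: "t \<in> carrier R" "t' = \<sigma> x0 t" using sigma_surjE[OF x0G t'(1)] by blast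
  have "\<sigma> x0 (a0 \<otimes> t \<otimes> u) \<notin> I" using t' t a0 u x0G by (simp add: sigma_mult)
  then have v: "a0 \<otimes> t \<otimes> u \<notin> I" using I_sigma_iff[OF x0G] a0 t u by simp
  \<comment> \<open>A left multiple of \<open>u\<close> outside \<open>I\<close> still has
    annihilator \<open>P\<close>, by maximality. Since \<open>b y0\<close> is not in
    \<open>P\<close>, this yields the factor \<open>r\<close>.\<close>
  have "annih_r R I {a0 \<otimes> t \<otimes> u} = P"
    unfolding P_def
    by (rule max) (use v a0 t u I.annih_r_mult in auto)
  then have "b y0 \<notin> annih_r R I {a0 \<otimes> t \<otimes> u}" using y0 by (simp add: Y_def)
  then obtain r where r: "r \<in> carrier R" "a0 \<otimes> t \<otimes> u \<otimes> r \<otimes> b y0 \<notin> I"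
    using S_coeff[OF bS] by (auto simp: annih_r_def)

  \<comment> \<open>The factor placed between \<open>a\<close> and \<open>b\<close>:
    \<open>t\<close> and \<open>r\<close> keep the term at \<open>(x0, y0)\<close> outside
    \<open>I\<close>, while \<open>u\<close> pushes the other terms at that product into
    \<open>I\<close>.\<close>
  define m where "m = t \<otimes> u \<otimes> r"
  have m: "m \<in> carrier R" using t u r by (simp add: m_def)
  define d where "d = cp_monom R \<one>\<^bsub>G\<^esub> m \<otimes>\<^bsub>S\<^esub> b"
  have d: "d \<in> B" using b m by (simp add: d_def B.I_l_closed cp_monom_closed)
  have dS: "d \<in> carrier S" using d by (rule B.Icarr)
  have d_eq: "d y = m \<otimes> b y" if "y \<in> carrier G" for y
    using monom_mult_coeff[OF G.one_closed m bS that] that m S_coeff[OF bS]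
    by (simp add: d_def sigma_one c_one_left)
  define q where "q = (\<lambda>(x, y). a x \<otimes> \<sigma> x (d y) \<otimes> c x y)"
  have qR: "q (x, y) \<in> carrier R" if "x \<in> carrier G" "y \<in> carrier G" for x y
    using that S_coeff[OF aS] S_coeff[OF dS] by (simp add: q_def)
  have in_I: "q (x, y) \<in> I"
    if xy: "x \<in> carrier G" "y \<in> carrier G" "x \<otimes>\<^bsub>G\<^esub> y = x0 \<otimes>\<^bsub>G\<^esub> y0" "(x, y) \<noteq> (x0, y0)" for x y
  proof -
    note [simp] = xy(1,2) t(1) u(1) r(1) S_coeff[OF aS] S_coeff[OF bS]
    \<comment> \<open>The factor \<open>\<sigma> x u\<close> can be grouped with either side. If
      \<open>x\<close> is in \<open>X\<close>, uniqueness puts \<open>b y\<close> into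
      \<open>P\<close>, so it is grouped to the right; otherwise it is grouped with
      \<open>a x\<close>.\<close>
    have *: "a x \<otimes> \<sigma> x (d y) = a x \<otimes> \<sigma> x t \<otimes> \<sigma> x u \<otimes> (\<sigma> x r \<otimes> \<sigma> x (b y))"
      by (simp add: d_eq m_def sigma_mult R.m_assoc)
    have "a x \<otimes> \<sigma> x (d y) \<in> I"
    proof (cases "x \<in> X")
      case True
      then have "y \<notin> Y" using uniq xy by blast
      then have "b y \<in> P" using xy(2) unfolding Y_def by blast
      then have "u \<otimes> r \<otimes> b y \<in> I" using r(1) unfolding P_def annih_r_def by blast
      then have "\<sigma> x (u \<otimes> r \<otimes> b y) \<in> I" by (simp add: I_sigma_iff)
      then have "(a x \<otimes> \<sigma> x t) \<otimes> \<sigma> x (u \<otimes> r \<otimes> b y) \<in> I" by (simp add: I.I_l_closed)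
      then show ?thesis by (simp add: * sigma_mult R.m_assoc)
    next
      case False
      then have "\<sigma> x u \<in> annih_r R I {a x}" using xy(1) unfolding X_def by blast
      then have "a x \<otimes> \<sigma> x t \<otimes> \<sigma> x u \<in> I"
        unfolding annih_r_def using sigma_closed[OF xy(1) t(1)] by blast
      then show ?thesis unfolding * by (simp add: I.I_r_closed)
    qed
    then show ?thesis by (simp add: q_def I.I_r_closed)
  qed
  have "a x0 \<otimes> \<sigma> x0 (d y0) = \<sigma> x0 (a0 \<otimes> t \<otimes> u \<otimes> r \<otimes> b y0)"
    using x0G y0G t u r a0 S_coeff[OF bS] by (simp add: d_eq m_def sigma_mult R.m_assoc)
  then have "a x0 \<otimes> \<sigma> x0 (d y0) \<notin> I"
    using r x0G t u a0 S_coeff[OF bS] by (simp add: I_sigma_iff)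
  then have notin: "q (x0, y0) \<notin> I"
    using x0G y0G S_coeff[OF aS] S_coeff[OF dS] by (simp add: q_def I_mult_unit_iff c_unit)

  \<comment> \<open>Inserting \<open>x0\<close> and \<open>y0\<close> allows the pair
    \<open>(x0, y0)\<close> to be split off from the sum.\<close>
  let ?X = "insert x0 (cp_supp R a)" and ?Y = "insert y0 (cp_supp R d)"
  let ?Z = "{(x, y) \<in> ?X \<times> ?Y. x \<otimes>\<^bsub>G\<^esub> y = x0 \<otimes>\<^bsub>G\<^esub> y0} - {(x0, y0)}"
  have XY: "finite ?X" "?X \<subseteq> carrier G" "finite ?Y" "?Y \<subseteq> carrier G"
    using aS dS x0G y0G by (auto simp: S_carrier)
  have Z: "finite ?Z"
    by (rule finite_subset[of _ "?X \<times> ?Y"]) (use XY in auto)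
  have ZI: "q p \<in> I" if "p \<in> ?Z" for p
    using that in_I subsetD[OF XY(2)] subsetD[OF XY(4)] by (cases p) auto
  have "(a \<otimes>\<^bsub>S\<^esub> d) (x0 \<otimes>\<^bsub>G\<^esub> y0) =
      finsum R q {(x, y) \<in> ?X \<times> ?Y. x \<otimes>\<^bsub>G\<^esub> y = x0 \<otimes>\<^bsub>G\<^esub> y0}"
    unfolding q_def by (rule S_mult_eq) (use aS dS XY in auto)
  also have "{(x, y) \<in> ?X \<times> ?Y. x \<otimes>\<^bsub>G\<^esub> y = x0 \<otimes>\<^bsub>G\<^esub> y0} = insert (x0, y0) ?Z" by auto
  also have "finsum R q \<dots> = q (x0, y0) \<oplus> finsum R q ?Z"
    by (rule R.finsum_insert) (use Z ZI I.Icarr qR x0G y0G in auto)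
  finally have sum: "(a \<otimes>\<^bsub>S\<^esub> d) (x0 \<otimes>\<^bsub>G\<^esub> y0) = q (x0, y0) \<oplus> finsum R q ?Z" .
  have rest: "finsum R q ?Z \<in> I" by (rule I.finsum_mem[OF Z ZI])
  have "a \<otimes>\<^bsub>S\<^esub> d \<in> cp_coeffs I" using AB ideal_prod.prod[OF a d] by blast
  \<comment> \<open>The whole coefficient and the sum of the remaining terms lie in
    \<open>I\<close>, so their difference \<open>q (x0, y0)\<close> would as well.\<close>
  then have "(a \<otimes>\<^bsub>S\<^esub> d) (x0 \<otimes>\<^bsub>G\<^esub> y0) \<ominus> finsum R q ?Z \<in> I"
    using rest by (simp add: cp_coeffs_def R.minus_eq I.a_closed I.a_inv_closed)
  moreover have "(a \<otimes>\<^bsub>S\<^esub> d) (x0 \<otimes>\<^bsub>G\<^esub> y0) \<ominus> finsum R q ?Z = q (x0, y0)"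
    using I.Icarr[OF rest] qR[OF x0G y0G] by (simp add: sum R.minus_eq R.a_assoc R.r_neg)
  ultimately show False using notin by simp
qed

end

section \<open>Equivalence of the two primeness conditions\<close>

theorem corollary4p7:
  fixes R :: "('r, 'm) ring_scheme" and G :: "('g, 'n) monoid_scheme"
    and \<sigma> :: "'g \<Rightarrow> 'r \<Rightarrow> 'r" and c :: "'g \<Rightarrow> 'g \<Rightarrow> 'r" and I :: "'r set"
  assumes "crossed_system R G \<sigma> c"
    and "unique_product_monoid G"
    and "G_invariant_ideal R G \<sigma> I"
    and "acc_on_ideals R"
    and "\<forall>g\<in>carrier G. \<sigma> g ` carrier R = carrier R"
  shows "S_prime R G \<sigma> c I \<longleftrightarrow>
    I \<noteq> carrier R \<and>
    (\<forall>J K. G_invariant_ideal R G \<sigma> J \<and> G_invariant_ideal R G \<sigma> K \<and> J \<cdot>\<^bsub>R\<^esub> K \<subseteq> I \<longrightarrow>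
       J \<subseteq> I \<or> K \<subseteq> I)"
    (is "_ \<longleftrightarrow> I \<noteq> carrier R \<and> ?prime")
proof -
  interpret crossed_system R G \<sigma> c by (rule assms(1))
  interpret invariant_ideal R G \<sigma> c I
    by unfold_locales (use assms in auto)
  \<comment> \<open>Primeness of \<open>IS\<close> includes properness, which becomes properness of
    \<open>I\<close>; \<open>cp_extension_eq\<close> replaces \<open>IS\<close> by its description
    through coefficients.\<close>
  have S_prime_iff: "S_prime R G \<sigma> c I \<longleftrightarrow> I \<noteq> carrier R \<and>
      (\<forall>A B. ideal A S \<and> ideal B S \<and> A \<cdot>\<^bsub>S\<^esub> B \<subseteq> cp_coeffs I \<longrightarrow> A \<subseteq> cp_coeffs I \<or> B \<subseteq> cp_coeffs I)"
    using cp_coeffs_ideal[OF inv] cp_coeffs_eq_carrier_iff[OF I_ideal]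
    by (simp add: S_prime_def prime_two_sided_ideal_def cp_extension_eq[OF I_ideal])
  \<comment> \<open>\<open>conj_cong\<close> makes \<open>I \<noteq> carrier R\<close> available
    while the two conditions are compared; the choice of a maximal annihilator relies on it.\<close>
  show ?thesis unfolding S_prime_iff
  proof (intro conj_cong refl iffI allI impI; (elim conjE)?)
    fix J K
    assume prime: "\<forall>A B. ideal A S \<and> ideal B S \<and> A \<cdot>\<^bsub>S\<^esub> B \<subseteq> cp_coeffs I \<longrightarrow>
        A \<subseteq> cp_coeffs I \<or> B \<subseteq> cp_coeffs I"
      and J: "G_invariant_ideal R G \<sigma> J" and K: "G_invariant_ideal R G \<sigma> K"
      and sub: "J \<cdot>\<^bsub>R\<^esub> K \<subseteq> I"
    have id: "ideal J R" "ideal K R" using J K by (simp_all add: G_invariant_ideal_def)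
    have "cp_coeffs J \<cdot>\<^bsub>S\<^esub> cp_coeffs K \<subseteq> cp_coeffs I"
      by (rule cp_coeffs_prod[OF id(1) K I_ideal sub])
    then have "cp_coeffs J \<subseteq> cp_coeffs I \<or> cp_coeffs K \<subseteq> cp_coeffs I"
      using prime cp_coeffs_ideal[OF J] cp_coeffs_ideal[OF K] by blast
    moreover have "cp_coeffs L \<subseteq> cp_coeffs I \<longleftrightarrow> L \<subseteq> I" if "ideal L R" for L
      using ideal.Icarr[OF that] additive_subgroup.zero_closed[OF ideal.axioms(1)[OF that]]
      by (intro cp_coeffs_mono_iff) auto
    ultimately show "J \<subseteq> I \<or> K \<subseteq> I" using id by blast
  next
    fix A B
    assume proper: "I \<noteq> carrier R" and prime: ?prime
      and AB: "ideal A S" "ideal B S" "A \<cdot>\<^bsub>S\<^esub> B \<subseteq> cp_coeffs I"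
    interpret G_prime_ideal R G \<sigma> c I
      by unfold_locales (use prime in blast)
    show "A \<subseteq> cp_coeffs I \<or> B \<subseteq> cp_coeffs I"
      by (rule cp_coeffs_prime[OF assms(2) proper AB])
  qed
qed

end
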